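(* Let $X=[n]$ be the disjoint union of sets $X_1,\dots,X_r$ ($r\ge 1$). Let $A_1,\dots,A_m,B_1,\dots,B_m\subseteq X$ be such that $\mathcal{P}=\{(A_i,B_i)\mid i\in[m]\}$ is a Bollobás system. Then $$\sum_{i=1}^m \left(\prod_{k=1}^r \binom{|A_i\cap X_k|+|B_i\cap X_k|}{|A_i\cap X_k|}\right)^{-1} \le \left(1+\frac{n}{r}\right)^{r-1}.$$
   Context: A family of pairs of sets $\mathcal{P}=\{(A_i,B_i)\mid i\in[m]\}$ is called a Bollobás system if for all $i,j\in[m]$: $A_i\cap B_j=\emptyset$ if and only if $i=j$. Here $[n]=\{1,\dots,n\}$. *)

theory Defs
  imports Complex_Main "HOL-Library.Disjoint_Sets"
begin

text \<open>The family of pairs is indexed, so the sum in the theorem counts each index once.\<close>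

definition bollobas_system :: "nat \<Rightarrow> (nat \<Rightarrow> 'a set) \<Rightarrow> (nat \<Rightarrow> 'a set) \<Rightarrow> bool" where
  "bollobas_system m A B \<longleftrightarrow>
     (\<forall>i\<in>{1..m}. \<forall>j\<in>{1..m}. A i \<inter> B j = {} \<longleftrightarrow> i = j)"

end

theory Submission
  imports Defs "HOL-Library.FuncSet" "HOL-Combinatorics.Multiset_Permutations"
begin

text \<open>
  Order each \<open>X\<^sub>k\<close> uniformly at random, independently. The reciprocal of the product of binomial
  coefficients is the probability that, for every \<open>k\<close>, some initial segment of length \<open>c\<^sub>k\<close> of
  \<open>X\<^sub>k\<close> contains \<open>A\<^sub>i \<inter> X\<^sub>k\<close> and misses \<open>B\<^sub>i \<inter> X\<^sub>k\<close>. For fixed orders, the cut vectors of two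
  distinct such indices are incomparable in the product of the chains \<open>{0..|X\<^sub>k|}\<close>, so forgetting
  one coordinate \<open>l\<close> is injective on them and there are at most \<open>\<Prod>k\<noteq>l. (|X\<^sub>k| + 1)\<close> such indices.
  Taking for \<open>l\<close> a block of at least average size, the bound follows from the AM-GM inequality.
\<close>

definition cuts :: "'a set \<Rightarrow> 'a set \<Rightarrow> 'a list \<Rightarrow> nat \<Rightarrow> bool" where
  "cuts A B xs c \<longleftrightarrow> c \<le> length xs \<and> A \<subseteq> set (take c xs) \<and> B \<inter> set (take c xs) = {}"

text \<open>For a duplicate-free \<open>xs\<close> with \<open>A\<close> contained in
  \<open>set xs\<close>, this says that all of \<open>A\<close> precedes all of \<open>B\<close>. It
  is phrased through a cut because cut positions of different indices are compared later.\<close>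

definition separates :: "'a set \<Rightarrow> 'a set \<Rightarrow> 'a list \<Rightarrow> bool" where
  "separates A B xs \<longleftrightarrow> (\<exists>c. cuts A B xs c)"

lemma separates_empty: "separates {} B xs"
  unfolding separates_def cuts_def by (rule exI[of _ 0]) simp

text \<open>A nonempty \<open>A\<close> rules out the cut at 0, which is the only cut that would
  allow the head to lie in \<open>B\<close>.\<close>

lemma separates_Cons:
  assumes "A \<noteq> {}"
  shows "separates A B (x # xs) \<longleftrightarrow> x \<notin> B \<and> separates (A - {x}) B xs"
proof
  assume "separates A B (x # xs)"
  then obtain c where c: "cuts A B (x # xs) c"
    unfolding separates_def by blast
  with assms obtain d where "c = Suc d"
    by (cases c) (auto simp: cuts_def)
  with c have "x \<notin> B" "cuts (A - {x}) B xs d"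
    by (auto simp: cuts_def)
  then show "x \<notin> B \<and> separates (A - {x}) B xs"
    unfolding separates_def by blast
next
  assume "x \<notin> B \<and> separates (A - {x}) B xs"
  then obtain c where "x \<notin> B" "cuts (A - {x}) B xs c"
    unfolding separates_def by blast
  then have "cuts A B (x # xs) (Suc c)"
    by (auto simp: cuts_def)
  then show "separates A B (x # xs)"
    unfolding separates_def by blast
qed

text \<open>In a random order of \<open>S\<close> each choice of the places taken by
  \<open>A\<close> among those of \<open>A \<union> B\<close> is equally likely, and only one of
  them puts \<open>A\<close> first. The induction conditions on the first entry.\<close>

lemma card_separating_permutations:
  assumes "finite S" "A \<subseteq> S" "B \<subseteq> S" "A \<inter> B = {}"
  shows "real (card {xs \<in> permutations_of_set S. separates A B xs})
         = fact (card S) * inverse (real ((card A + card B) choose card A))"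
  using assms
proof (induction "card S" arbitrary: S A)
  case 0
  then have "S = {}" "A = {}" "B = {}" by auto
  then show ?case by (simp add: separates_empty)
next
  case (Suc s)
  \<comment> \<open>Only \<open>S\<close> and \<open>A\<close> vary: deleting the first entry
    shrinks them but leaves \<open>B\<close> intact, as that entry is never in
    \<open>B\<close>.\<close>
  define G where "G S A = {xs \<in> permutations_of_set S. separates A B xs}" for S A :: "'a set"
  show ?case
  proof (cases "A = {}")
    case True
    with Suc.prems show ?thesis by (simp add: separates_empty)
  next
    case False
    have fin: "finite A" "finite B" using Suc.prems finite_subset by blast+
    define C where "C = real ((card A + card B) choose card A)"
    have C: "C > 0" by (simp add: C_def)
    have "S \<noteq> {}" using Suc by auto
    then have "permutations_of_set S = (\<Union>x\<in>S. (#) x ` permutations_of_set (S - {x}))"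
      by (rule permutations_of_set_nonempty)
    then have mem: "xs \<in> G S A \<longleftrightarrow> (\<exists>x\<in>S. \<exists>ys\<in>permutations_of_set (S - {x}).
        xs = x # ys \<and> x \<notin> B \<and> separates (A - {x}) B ys)" for xs
      by (auto simp: G_def image_iff separates_Cons[OF False])
    have "G S A = (\<Union>x\<in>S - B. (#) x ` G (S - {x}) (A - {x}))"
      unfolding set_eq_iff mem by (auto simp: G_def)
    moreover have "card (\<Union>x\<in>S - B. (#) x ` G (S - {x}) (A - {x}))
        = (\<Sum>x\<in>S - B. card ((#) x ` G (S - {x}) (A - {x})))"
      using Suc.prems by (intro card_UN_disjoint) (auto simp: G_def)
    ultimately have "real (card (G S A)) = (\<Sum>x\<in>S - B. real (card (G (S - {x}) (A - {x}))))"
      by (simp add: card_image)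
    \<comment> \<open>A first entry in \<open>A\<close> lowers \<open>card A\<close> by one and so
      changes the binomial coefficient; any other admissible one leaves \<open>A\<close>, hence
      \<open>C\<close>, unchanged.\<close>
    also have "\<dots> = (\<Sum>x\<in>S - B. if x \<in> A then fact s * (real (card A + card B) / (real (card A) * C))
                                  else fact s / C)"
    proof (rule sum.cong[OF refl])
      fix x assume x: "x \<in> S - B"
      have cs: "s = card (S - {x})" using Suc x by simp
      have IH: "real (card (G (S - {x}) (A - {x}))) =
          fact s * inverse (real ((card (A - {x}) + card B) choose card (A - {x})))"
        unfolding G_def cs by (rule Suc.hyps(1)[OF cs]) (use Suc.prems x in auto)
      show "real (card (G (S - {x}) (A - {x}))) =
          (if x \<in> A then fact s * (real (card A + card B) / (real (card A) * C)) else fact s / C)"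
      proof (cases "x \<in> A")
        case True
        then obtain a where a: "card A = Suc a" "card (A - {x}) = a"
          using fin by (metis card_Suc_Diff1)
        define D where "D = real ((a + card B) choose a)"
        have D: "D > 0" by (simp add: D_def)
        \<comment> \<open>The absorption identity relates \<open>C\<close> to the coefficient
          \<open>D\<close> for \<open>A - {x}\<close>.\<close>
        have "Suc a * (Suc (a + card B) choose Suc a) = Suc (a + card B) * ((a + card B) choose a)"
          by (simp only: Suc_times_binomial_eq mult.commute)
        then have "real (Suc a) * C = real (Suc (a + card B)) * D"
          unfolding C_def D_def a(1) add_Suc of_nat_mult[symmetric] by (rule arg_cong)
        then have "inverse D = real (card A + card B) / (real (card A) * C)"
          using D by (simp add: a(1) inverse_eq_divide flip: of_nat_add del: of_nat_Suc)
        with True IH show ?thesis by (simp add: a D_def)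
      next
        case False
        with IH show ?thesis by (simp add: C_def field_simps)
      qed
    qed
    also have "\<dots> = (\<Sum>x\<in>A. fact s * (real (card A + card B) / (real (card A) * C)))
                     + (\<Sum>x\<in>S - B - A. fact s / C)"
    proof -
      have "(S - B) \<inter> A = A" "(S - B) \<inter> - A = S - B - A" using Suc.prems by auto
      then show ?thesis
        using Suc.prems by (simp only: sum.If_cases finite_Diff Collect_mem_eq Collect_neg_eq)
    qed
    \<comment> \<open>The factor \<open>card A\<close> from summing over \<open>A\<close> cancels
      the denominator. The bracket then counts all of \<open>S\<close>, which raises
      \<open>fact s\<close> to \<open>fact (Suc s)\<close>.\<close>
    also have "\<dots> = fact s * (real (card A + card B) + real (card (S - B - A))) / C"
      using False fin C by (simp add: field_simps)
    also have "card A + card B + card (S - B - A) = Suc s"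
    proof -
      have "card (A \<union> B) = card A + card B"
        using Suc.prems fin by (simp add: card_Un_disjoint)
      moreover have "card (S - (A \<union> B)) = card S - card (A \<union> B)"
        using Suc.prems fin by (intro card_Diff_subset) auto
      moreover have "card (A \<union> B) \<le> card S"
        using Suc.prems by (intro card_mono) auto
      moreover have "S - B - A = S - (A \<union> B)" by auto
      ultimately show ?thesis using Suc.hyps(2) by simp
    qed
    then have "fact s * (real (card A + card B) + real (card (S - B - A))) / C = fact (Suc s) / C"
      by (simp flip: of_nat_add add: mult.commute)
    finally show ?thesis
      using Suc.hyps(2) by (simp add: G_def C_def field_simps)
  qed
qed

text \<open>Cut vectors that agree outside \<open>l\<close> are comparable, since cut positions in
  \<open>f l\<close> are linearly ordered, and comparable cut vectors belong to the same
  index.\<close>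

lemma card_separated_indices_le:
  fixes X :: "'k \<Rightarrow> 'a set" and A B :: "'i \<Rightarrow> 'a set"
  assumes "finite K" "l \<in> K"
    and A: "\<And>i. i \<in> I \<Longrightarrow> A i \<subseteq> (\<Union>k\<in>K. X k)"
    and cross: "\<And>i j. i \<in> I \<Longrightarrow> j \<in> I \<Longrightarrow> A i \<inter> B j = {} \<Longrightarrow> i = j"
    and f: "f \<in> (\<Pi>\<^sub>E k\<in>K. permutations_of_set (X k))"
  shows "card {i \<in> I. \<forall>k\<in>K. separates (A i \<inter> X k) (B i \<inter> X k) (f k)}
         \<le> (\<Prod>k\<in>K - {l}. card (X k) + 1)"
proof -
  define J where "J = {i \<in> I. \<forall>k\<in>K. separates (A i \<inter> X k) (B i \<inter> X k) (f k)}"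
  have "\<exists>c. cuts (A i \<inter> X k) (B i \<inter> X k) (f k) c" if "i \<in> J" "k \<in> K" for i k
    using that by (auto simp: J_def separates_def)
  then obtain c where c: "\<And>i k. i \<in> J \<Longrightarrow> k \<in> K \<Longrightarrow> cuts (A i \<inter> X k) (B i \<inter> X k) (f k) (c i k)"
    by metis
  have le_imp_eq: "i = j" if ij: "i \<in> J" "j \<in> J" and le: "\<And>k. k \<in> K \<Longrightarrow> c i k \<le> c j k" for i j
  proof -
    \<comment> \<open>The prefix containing \<open>A i \<inter> X k\<close> lies inside the longer
      prefix that misses \<open>B j \<inter> X k\<close>.\<close>
    have "A i \<inter> B j \<inter> X k = {}" if k: "k \<in> K" for k
      using c[OF ij(1) k] c[OF ij(2) k] set_take_subset_set_take[OF le[OF k], of "f k"]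
      unfolding cuts_def by blast
    then have "A i \<inter> B j = {}"
      using A[of i] ij by (fastforce simp: J_def)
    then show ?thesis using cross ij by (auto simp: J_def)
  qed
  define R where "R i = restrict (c i) (K - {l})" for i
  have inj: "inj_on R J"
  proof (rule inj_onI)
    fix i j assume ij: "i \<in> J" "j \<in> J" and eq: "R i = R j"
    have same: "c i k = c j k" if "k \<in> K" "k \<noteq> l" for k
      using fun_cong[OF eq, of k] that by (simp add: R_def)
    show "i = j"
    proof (cases "c i l \<le> c j l")
      case True
      with same show ?thesis using ij by (intro le_imp_eq) (metis order_refl)+
    next
      case False
      with same have "j = i" using ij by (intro le_imp_eq) (metis order_refl nle_le)+
      then show ?thesis ..
    qed
  qed
  have "length (f k) = card (X k)" if "k \<in> K" for k
    using f that by (intro length_finite_permutations_of_set) auto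
  \<comment> \<open>Cuts at both ends are allowed, so a block offers \<open>card (X k) + 1\<close>
    positions.\<close>
  then have "R ` J \<subseteq> (\<Pi>\<^sub>E k\<in>K - {l}. {..card (X k)})"
    using c by (force simp: R_def cuts_def)
  then have "card J \<le> card (\<Pi>\<^sub>E k\<in>K - {l}. {..card (X k)})"
    using \<open>finite K\<close> by (intro card_inj_on_le[OF inj] finite_PiE) auto
  then show ?thesis
    using \<open>finite K\<close> by (simp add: card_PiE J_def)
qed

text \<open>Double counting of the pairs of an index \<open>i\<close> and a tuple \<open>f\<close>
  of orders that separates it: each \<open>i\<close> occurs with the fraction \<open>?w i\<close> of
  all tuples, each \<open>f\<close> with at most \<open>?N\<close> indices.\<close>

lemma partitioned_bollobas_inequality:
  fixes X :: "'k \<Rightarrow> 'a set" and A B :: "'i \<Rightarrow> 'a set"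
  assumes "finite K" "l \<in> K" "finite I"
    and X: "\<And>k. k \<in> K \<Longrightarrow> finite (X k)"
    and A: "\<And>i. i \<in> I \<Longrightarrow> A i \<subseteq> (\<Union>k\<in>K. X k)"
    and cross: "\<And>i j. i \<in> I \<Longrightarrow> j \<in> I \<Longrightarrow> A i \<inter> B j = {} \<longleftrightarrow> i = j"
  shows "(\<Sum>i\<in>I. inverse (\<Prod>k\<in>K.
            real ((card (A i \<inter> X k) + card (B i \<inter> X k)) choose card (A i \<inter> X k))))
         \<le> real (\<Prod>k\<in>K - {l}. card (X k) + 1)"
    (is "(\<Sum>i\<in>I. ?w i) \<le> real ?N")
proof -
  define P where "P = (\<Pi>\<^sub>E k\<in>K. permutations_of_set (X k))"
  define Sep where "Sep i f \<longleftrightarrow> (\<forall>k\<in>K. separates (A i \<inter> X k) (B i \<inter> X k) (f k))"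
    for i and f :: "'k \<Rightarrow> 'a list"
  have "finite P"
    unfolding P_def using \<open>finite K\<close> by (intro finite_PiE) auto
  have "card P = (\<Prod>k\<in>K. fact (card (X k)))"
    unfolding P_def using \<open>finite K\<close> X by (simp add: card_PiE)
  then have cardP: "real (card P) = (\<Prod>k\<in>K. fact (card (X k)))"
    by simp
  then have "real (card P) > 0"
    by (simp add: prod_pos)
  have w: "real (card {f \<in> P. Sep i f}) = real (card P) * ?w i" if "i \<in> I" for i
  proof -
    \<comment> \<open>The condition on \<open>f\<close> splits over the blocks, so the count is a
      product of one-block counts.\<close>
    have "{f \<in> P. Sep i f} =
        (\<Pi>\<^sub>E k\<in>K. {xs \<in> permutations_of_set (X k). separates (A i \<inter> X k) (B i \<inter> X k) xs})"
      by (auto simp: P_def Sep_def PiE_iff extensional_def)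
    then have "real (card {f \<in> P. Sep i f}) =
        (\<Prod>k\<in>K. real (card {xs \<in> permutations_of_set (X k). separates (A i \<inter> X k) (B i \<inter> X k) xs}))"
      using \<open>finite K\<close> by (simp add: card_PiE)
    also have "\<dots> = (\<Prod>k\<in>K. fact (card (X k)) *
        inverse (real ((card (A i \<inter> X k) + card (B i \<inter> X k)) choose card (A i \<inter> X k))))"
      using X cross[OF that that] by (intro prod.cong[OF refl] card_separating_permutations) auto
    finally show ?thesis
      by (simp add: prod.distrib cardP prod_inversef[unfolded o_def])
  qed
  have "real (card P) * (\<Sum>i\<in>I. ?w i) = real (\<Sum>i\<in>I. card {f \<in> P. Sep i f})"
    by (simp add: sum_distrib_left w)
  also have "(\<Sum>i\<in>I. card {f \<in> P. Sep i f}) = (\<Sum>f\<in>P. card {i \<in> I. Sep i f})"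
    using \<open>finite I\<close> \<open>finite P\<close> by (intro sum_multicount_gen) auto
  also have "\<dots> \<le> card P * ?N"
    unfolding P_def Sep_def using assms
    by (intro sum_bounded_above[of _ _ ?N, unfolded of_nat_id] card_separated_indices_le) auto
  finally have "real (card P) * (\<Sum>i\<in>I. ?w i) \<le> real (card P) * real ?N"
    by simp
  then show ?thesis
    using \<open>real (card P) > 0\<close> by (simp only: mult_le_cancel_left_pos)
qed

text \<open>AM-GM with an upper bound \<open>t\<close> on the mean: multiply
  \<open>u \<le> exp (u - 1)\<close> over \<open>u = y k / t\<close>; the exponents sum to at most
  0.\<close>

lemma prod_le_power_if_sum_le:
  fixes y :: "'k \<Rightarrow> real"
  assumes "t > 0" "\<And>k. k \<in> K \<Longrightarrow> y k \<ge> 0" "(\<Sum>k\<in>K. y k) \<le> real (card K) * t"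
  shows "(\<Prod>k\<in>K. y k) \<le> t ^ card K"
proof (cases "finite K")
  case True
  have "(\<Prod>k\<in>K. y k / t) \<le> (\<Prod>k\<in>K. exp (y k / t - 1))"
  proof (rule prod_mono)
    fix k assume "k \<in> K"
    then show "0 \<le> y k / t \<and> y k / t \<le> exp (y k / t - 1)"
      using assms exp_ge_add_one_self[of "y k / t - 1"] by simp
  qed
  also have "\<dots> = exp ((\<Sum>k\<in>K. y k) / t - real (card K))"
    using True by (simp add: exp_sum[symmetric] sum_subtractf sum_divide_distrib)
  also have "\<dots> \<le> 1"
    using assms by (simp add: field_simps)
  finally show ?thesis
    using assms by (simp add: prod_dividef field_simps)
\<comment> \<open>For infinite \<open>K\<close> the product and the power are both 1 by
  convention.\<close>
qed simp

theorem theorem1p9: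
  fixes n r m :: nat
    and X A B :: "nat \<Rightarrow> nat set"
  assumes "r \<ge> 1"
    and "disjoint_family_on X {1..r}"
    and "(\<Union>k\<in>{1..r}. X k) = {1..n}"
    and "\<And>i. i \<in> {1..m} \<Longrightarrow> A i \<subseteq> {1..n}"
    and "\<And>i. i \<in> {1..m} \<Longrightarrow> B i \<subseteq> {1..n}"
    and "bollobas_system m A B"
  shows "(\<Sum>i=1..m. inverse (\<Prod>k=1..r.
            real ((card (A i \<inter> X k) + card (B i \<inter> X k)) choose card (A i \<inter> X k))))
         \<le> (1 + real n / real r) ^ (r - 1)"
proof -
  \<comment> \<open>The average of \<open>card (X k) + 1\<close> over the \<open>r\<close>
    blocks.\<close>
  define t where "t = 1 + real n / real r"
  define y where "y k = real (card (X k) + 1)" for k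
  have "t > 0" by (simp add: t_def add_pos_nonneg)
  have X: "finite (X k)" if "k \<in> {1..r}" for k
    using assms(3) that by (metis UN_upper finite_atLeastAtMost finite_subset)
  have "card (\<Union>k\<in>{1..r}. X k) = (\<Sum>k=1..r. card (X k))"
    using X assms(2) by (intro card_UN_disjoint') auto
  then have n: "n = (\<Sum>k=1..r. card (X k))"
    unfolding assms(3) by simp
  have sum_y: "(\<Sum>k=1..r. y k) = real r * t"
    using \<open>r \<ge> 1\<close> by (simp add: y_def t_def n sum.distrib field_simps)
  have "\<exists>l\<in>{1..r}. y l \<ge> t"
  proof (rule ccontr)
    assume "\<not> ?thesis"
    then have "(\<Sum>k=1..r. y k) < (\<Sum>k=1..r. t)"
      using \<open>r \<ge> 1\<close> by (intro sum_strict_mono) (auto simp: not_le)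
    then show False unfolding sum_y by simp
  qed
  then obtain l where l: "l \<in> {1..r}" "y l \<ge> t" by blast
  have card_l: "card ({1..r} - {l}) = r - 1"
    using l by simp
  have "(\<Sum>i=1..m. inverse (\<Prod>k=1..r.
            real ((card (A i \<inter> X k) + card (B i \<inter> X k)) choose card (A i \<inter> X k))))
        \<le> real (\<Prod>k\<in>{1..r} - {l}. card (X k) + 1)"
    using l X assms by (intro partitioned_bollobas_inequality) (auto simp: bollobas_system_def)
  also have "\<dots> = (\<Prod>k\<in>{1..r} - {l}. y k)"
    by (simp add: y_def)
  also have "\<dots> \<le> t ^ card ({1..r} - {l})"
  proof (rule prod_le_power_if_sum_le[OF \<open>t > 0\<close>])
    \<comment> \<open>Dropping a block of at least average size leaves the remaining
      \<open>r - 1\<close> terms with mean at most \<open>t\<close>.\<close>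
    have "(\<Sum>k\<in>{1..r} - {l}. y k) = real r * t - y l"
      unfolding sum_y[symmetric] using l by (simp add: sum_diff1)
    also have "\<dots> \<le> real (r - 1) * t"
      using l \<open>r \<ge> 1\<close> by (simp add: of_nat_diff algebra_simps)
    finally show "(\<Sum>k\<in>{1..r} - {l}. y k) \<le> real (card ({1..r} - {l})) * t"
      unfolding card_l .
  qed (simp add: y_def)
  finally show ?thesis
    unfolding card_l t_def .
qed

end
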